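(* Let $l\ge 1$ and $n\ge 2$ be integers and let $\mathcal A=\{a_1<a_2<\dots<a_l\}$ be a totally ordered alphabet. Let $\mathcal M$ be the set of all words over $\mathcal A$ that are not $n$-divisible, and let $Y$ be the set of all nonempty words over $\mathcal A$ of length less than $n$. Then the height of $\mathcal M$ over $Y$ is at most $$\Phi(n,l)=2^{96}\, l\, n^{12\log_3 n+36\log_3\log_3 n+91}.$$
   Context: Words are finite sequences of letters; a subword means a contiguous factor. Two words $u,v$ are called comparable if neither is a prefix of the other (in particular equal words are not comparable). For comparable $u,v$ write $u\succ v$ if at the first position where $u$ and $v$ differ the letter of $u$ is larger. A word $W$ is $n$-divisible if it contains a subword of the form $u_1u_2\cdots u_n$ with nonempty words $u_i$ satisfying $u_1\succ u_2\succ\dots\succ u_n$. The height of a set of words $\mathcal M$ over a set of words $Y$ is the least integer $h$ such that every word of $\mathcal M$ can be written as $y_1^{k_1}y_2^{k_2}\cdots y_r^{k_r}$ with $y_i\in Y$, $k_i\ge 1$ integers and $r\le h$. *)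

theory Defs
  imports Complex_Main "HOL-Library.Sublist"
begin

definition comparable :: "'a list \<Rightarrow> 'a list \<Rightarrow> bool" where
  "comparable u v \<longleftrightarrow> \<not> prefix u v \<and> \<not> prefix v u"

definition word_gt :: "'a::linorder list \<Rightarrow> 'a list \<Rightarrow> bool" where
  "word_gt u v \<longleftrightarrow> comparable u v \<and>
     (\<exists>p a b s t. u = p @ [a] @ s \<and> v = p @ [b] @ t \<and> b < a)"

definition n_divisible :: "nat \<Rightarrow> 'a::linorder list \<Rightarrow> bool" where
  "n_divisible n W \<longleftrightarrow> (\<exists>x us z. W = x @ concat us @ z \<and> length us = n \<and>
      (\<forall>u\<in>set us. u \<noteq> []) \<and>
      (\<forall>i. Suc i < n \<longrightarrow> word_gt (us ! i) (us ! Suc i)))"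

definition piecewise_power :: "'a list set \<Rightarrow> nat \<Rightarrow> 'a list \<Rightarrow> bool" where
  "piecewise_power Y r W \<longleftrightarrow> (\<exists>ys ks. length ys = r \<and> length ks = r \<and>
      set ys \<subseteq> Y \<and> (\<forall>k\<in>set ks. 1 \<le> k) \<and>
      W = concat (map (\<lambda>(y, k). concat (replicate k y)) (zip ys ks)))"

definition height_le :: "'a list set \<Rightarrow> 'a list set \<Rightarrow> nat \<Rightarrow> bool" where
  "height_le M Y h \<longleftrightarrow> (\<forall>W\<in>M. \<exists>r\<le>h. piecewise_power Y r W)"

definition height :: "'a list set \<Rightarrow> 'a list set \<Rightarrow> nat" where
  "height M Y = (LEAST h. height_le M Y h)"

definition Phi :: "nat \<Rightarrow> nat \<Rightarrow> real" where
  "Phi n l = 2 ^ 96 * real l *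
     real n powr (12 * log 3 (real n) + 36 * log 3 (log 3 (real n)) + 91)"

end

theory Submission
  imports Defs "HOL-Library.List_Lexorder"
begin

text \<open>
  Fix a power of two \<open>D\<close> with \<open>2 n \<le> D < 4 n\<close> and relate positions \<open>p\<close>, \<open>q\<close> of a word \<open>W\<close> if they are at
  least \<open>D\<close> apart and the factor of length \<open>D\<close> at \<open>p\<close> is larger than the one at \<open>q\<close>. A chain of
  \<open>n\<close> positions exhibits \<open>W\<close> as \<open>n\<close>-divisible, so otherwise the positions can be coloured with
  \<open>n - 1\<close> colours such that, for every \<open>k \<le> D\<close>, the factors of length \<open>k\<close> at positions of one colour
  weakly increase, except possibly between positions less than \<open>D\<close> apart. Call a position a record
  of level \<open>k\<close> if its factor of length \<open>k\<close> strictly exceeds all earlier ones of its colour.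
  Away from the \<open>D\<close> positions after a record, the colour determines the factor of length \<open>k\<close> until
  the next record; a factor of length \<open>2 k\<close> consists of two of length \<open>k\<close>, so passing from level
  \<open>k\<close> to \<open>2 k\<close> multiplies the number of records by at most \<open>n\<^sup>2 + 2 D\<close>. There are at most
  \<open>(n - 1) l\<close> records of level 1, hence at most \<open>l n\<close> times a factor \<open>(n\<^sup>2 + 2 D) ^ log\<^sub>2 D\<close> of level \<open>D\<close>. On a
  stretch without influence of records of level \<open>D\<close>, two of any \<open>n\<close> consecutive positions carry the
  same factor of length \<open>D \<ge> 2 n\<close>, which makes the stretch periodic with a period less than \<open>n\<close>.
\<close>

section \<open>Chains of decreasing factors and n-divisibility\<close>

text \<open>Equal lengths exclude the prefix case of the lexicographic order, so the order is
  decided at a differing letter, which survives every continuation.\<close>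

lemma list_less_append_word_gt:
  fixes x y :: "'a::linorder list"
  assumes "x < y" "length x = length y"
  shows "word_gt (y @ s) (x @ t)"
proof -
  from assms obtain p a b v w where *: "a < b" "x = p @ a # v" "y = p @ b # w"
    by (auto simp: list_less_def lexord_def)
  then have "comparable (y @ s) (x @ t)"
    by (auto simp: comparable_def)
  moreover have "y @ s = p @ [b] @ (w @ s)" "x @ t = p @ [a] @ (v @ t)"
    using * by auto
  ultimately show ?thesis
    using \<open>a < b\<close> unfolding word_gt_def by blast
qed

lemma take_mono_lex:
  fixes x y :: "'a::linorder list"
  assumes "x \<le> y"
  shows "take k x \<le> take k y"
  using assms
proof (induction k arbitrary: x y)
  case 0
  then show ?case by simp
next
  case (Suc k)
  then show ?case
    by (cases x; cases y) (auto simp: list_le_def)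
qed

lemma concat_slices:
  assumes "\<And>i. i < m \<Longrightarrow> q i \<le> q (Suc i)"
  shows "q 0 \<le> q m \<and>
    concat (map (\<lambda>i. take (q (Suc i) - q i) (drop (q i) W)) [0..<m]) = take (q m - q 0) (drop (q 0) W)"
  using assms
proof (induction m)
  case (Suc m)
  then have IH: "q 0 \<le> q m"
    "concat (map (\<lambda>i. take (q (Suc i) - q i) (drop (q i) W)) [0..<m]) = take (q m - q 0) (drop (q 0) W)"
    by auto
  have le: "q m \<le> q (Suc m)" using Suc.prems by simp
  have "take (q (Suc m) - q 0) (drop (q 0) W)
      = take ((q m - q 0) + (q (Suc m) - q m)) (drop (q 0) W)"
    using IH(1) le by simp
  also have "\<dots> = take (q m - q 0) (drop (q 0) W) @ take (q (Suc m) - q m) (drop (q m) W)"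
    using IH(1) by (simp only: take_add drop_drop) simp
  finally show ?case using IH le by simp
qed auto

text \<open>The bound \<open>q + D <= length W\<close> gives both factors full length
  \<open>D\<close>, so the strict inequality comes from a differing letter and never from one factor
  being a prefix of the other.\<close>

definition prefix_drop :: "nat \<Rightarrow> 'a::linorder list \<Rightarrow> nat \<Rightarrow> nat \<Rightarrow> bool" where
  "prefix_drop D W p q \<longleftrightarrow>
     p + D \<le> q \<and> q + D \<le> length W \<and> take D (drop q W) < take D (drop p W)"

text \<open>Cut \<open>W\<close> at the positions of the chain. Consecutive cuts are at least
  \<open>D\<close> apart, so each block starts with its factor of length \<open>D\<close>, and these
  factors already decide the comparison.\<close>

lemma chain_imp_n_divisible:
  assumes ch: "successively (prefix_drop D W) ps" and n: "length ps = n" "n \<ge> 2" and "D > 0"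
  shows "n_divisible n W"
proof -
  \<comment> \<open>The extra value at \<open>i = n\<close> ends the last block, which gets exactly
    \<open>D\<close> letters.\<close>
  define q where "q i = (if i < n then ps ! i else ps ! (n - 1) + D)" for i
  have step: "prefix_drop D W (ps ! i) (ps ! Suc i)" if "Suc i < n" for i
    using ch n that by (auto simp: successively_conv_nth)
  have gap: "q i + D \<le> q (Suc i)" if "i < n" for i
  proof (cases "Suc i < n")
    case True
    then show ?thesis using step[of i] by (simp add: q_def prefix_drop_def)
  next
    case False
    then have "i = n - 1" using that by simp
    then show ?thesis using n by (simp add: q_def)
  qed
  define us where "us = map (\<lambda>i. take (q (Suc i) - q i) (drop (q i) W)) [0..<n]"
  have len: "q n \<le> length W"
    using step[of "n - 2"] n by (auto simp: q_def prefix_drop_def numeral_2_eq_2 Suc_diff_Suc)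
  have mono: "q i \<le> q n" if "i \<le> n" for i
    using that
  proof (induction i rule: inc_induct)
    case (step i)
    then show ?case using gap[of i] by simp
  qed simp
  have cs: "q 0 \<le> q n" "concat us = take (q n - q 0) (drop (q 0) W)"
    using concat_slices[of n q W] gap unfolding us_def by fastforce+
  have "take (q n) W = take (q 0) W @ concat us"
    using cs take_add[of "q 0" "q n - q 0" W] by simp
  then have "W = take (q 0) W @ concat us @ drop (q n) W"
    by (metis append.assoc append_take_drop_id)
  moreover have "length us = n" by (simp add: us_def)
  moreover have "u \<noteq> []" if "u \<in> set us" for u
  proof -
    from that obtain i where i: "i < n" "u = take (q (Suc i) - q i) (drop (q i) W)"
      by (auto simp: us_def)
    have "length u = q (Suc i) - q i" using i mono[of "Suc i"] len by simp
    then show ?thesis using gap[OF i(1)] \<open>D > 0\<close> by auto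
  qed
  moreover have "word_gt (us ! i) (us ! Suc i)" if i: "Suc i < n" for i
  proof -
    have pre: "take (q (Suc j) - q j) (drop (q j) W) = take D (drop (ps ! j) W) @
        take (q (Suc j) - q j - D) (drop D (drop (ps ! j) W))" if "j < n" for j
      using gap[OF that] that take_add[of D "q (Suc j) - q j - D" "drop (q j) W"]
      by (simp add: q_def del: drop_drop)
    have "length (take D (drop (ps ! Suc i) W)) = length (take D (drop (ps ! i) W))"
      using step[OF i] by (auto simp: prefix_drop_def)
    then show ?thesis
      using i step[OF i] pre[of i] pre[of "Suc i"]
      by (simp add: us_def prefix_drop_def list_less_append_word_gt del: length_take)
  qed
  ultimately show ?thesis unfolding n_divisible_def by blast
qed

section \<open>Colouring by chain length\<close>

text \<open>As in Mirsky's theorem, the colour of \<open>p\<close> is the number of steps in a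
  longest chain starting at \<open>p\<close>. If \<open>R p q\<close>, putting \<open>p\<close> in
  front of a longest chain from \<open>q\<close> makes the colour of \<open>p\<close>
  larger.\<close>

lemma chain_colouring:
  assumes "\<And>ps. successively R ps \<Longrightarrow> length ps \<noteq> n" and "n > 0"
  obtains c :: "'a \<Rightarrow> nat" where "\<And>p. c p < n - 1" "\<And>p q. R p q \<Longrightarrow> c p \<noteq> c q"
proof -
  have short: "length ps < n" if "successively R ps" for ps
  proof (rule ccontr)
    assume "\<not> length ps < n"
    moreover have "successively R (take n ps)"
      using that by (metis append_take_drop_id successively_append_iff)
    ultimately show False using assms(1)[of "take n ps"] by simp
  qed
  define L where "L p = {m. \<exists>ps. length ps = m \<and> successively R (p # ps)}" for p
  have L: "m < n - 1" if "m \<in> L p" for m p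
    using that short[of "p # _"] by (fastforce simp: L_def)
  then have fin: "finite (L p)" for p
    by (meson finite_lessThan finite_subset lessThan_iff subsetI)
  have "0 \<in> L p" for p by (simp add: L_def)
  then have Max_in: "Max (L p) \<in> L p" for p using fin Max_in by blast
  show thesis
  proof (rule that[of "\<lambda>p. Max (L p)"])
    show "Max (L p) < n - 1" for p using L[OF Max_in] .
    fix p q assume R: "R p q"
    from Max_in[of q] obtain ps where ps: "length ps = Max (L q)" "successively R (q # ps)"
      by (auto simp: L_def)
    then have "successively R (p # q # ps)" using R by simp
    then have "Suc (Max (L q)) \<in> L p" using ps unfolding L_def by (auto intro!: exI[of _ "q # ps"])
    then show "Max (L p) \<noteq> Max (L q)" using Max_ge[OF fin[of p]] by fastforce
  qed
qed

section \<open>Records of a coloured sequence\<close>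

text \<open>These are the strict left-to-right maxima within each colour class.\<close>

definition records :: "nat \<Rightarrow> (nat \<Rightarrow> nat) \<Rightarrow> (nat \<Rightarrow> 'b::linorder) \<Rightarrow> nat set" where
  "records N c f = {q. q < N \<and> (\<forall>p<q. c p = c q \<longrightarrow> f p < f q)}"

text \<open>Positions at which the monotonicity at distance \<open>D\<close> already compares with all records so far.\<close>

definition settled :: "nat \<Rightarrow> nat \<Rightarrow> (nat \<Rightarrow> nat) \<Rightarrow> (nat \<Rightarrow> 'b::linorder) \<Rightarrow> nat set" where
  "settled D N c f = {q. q < N \<and> (\<forall>r\<in>records N c f. r \<le> q \<longrightarrow> r + D \<le> q)}"

lemma finite_records [simp]: "finite (records N c f)"
  by (simp add: records_def)

lemma card_unsettled: "card ({..<N} - settled D N c f) \<le> D * card (records N c f)"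
proof -
  have "{..<N} - settled D N c f \<subseteq> (\<Union>r\<in>records N c f. {r..<r + D})"
    by (auto simp: settled_def)
  then have "card ({..<N} - settled D N c f) \<le> card (\<Union>r\<in>records N c f. {r..<r + D})"
    by (intro card_mono) auto
  also have "\<dots> \<le> (\<Sum>r\<in>records N c f. card {r..<r + D})"
    by (rule card_UN_le) simp
  finally show ?thesis by (simp add: mult.commute)
qed

text \<open>The leftmost maximiser of \<open>f\<close> among the positions up to \<open>q\<close> of
  its colour is a record. As \<open>q\<close> is settled, this record lies at least \<open>D\<close>
  before \<open>q\<close>, where \<open>mono\<close> applies.\<close>

lemma settled_max:
  assumes mono: "\<And>p q. p + D \<le> q \<Longrightarrow> q < N \<Longrightarrow> c p = c q \<Longrightarrow> f p \<le> f q"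
    and q: "q \<in> settled D N c f" and p: "p \<le> q" "c p = c q"
  shows "f p \<le> f q"
proof -
  define S where "S = {p. p \<le> q \<and> c p = c q}"
  have S: "finite S" "q \<in> S" by (auto simp: S_def)
  define r where "r = (LEAST r. r \<in> S \<and> f r = Max (f ` S))"
  have "\<exists>r. r \<in> S \<and> f r = Max (f ` S)"
    using Max_in[of "f ` S"] S by fastforce
  then have r: "r \<in> S" "f r = Max (f ` S)"
    unfolding r_def by (metis (mono_tags, lifting) LeastI)+
  have "f p' < f r" if "p' < r" "c p' = c r" for p'
  proof -
    have "p' \<in> S" using that r by (auto simp: S_def)
    moreover have "f p' \<noteq> Max (f ` S)"
      using not_less_Least[of p' "\<lambda>r. r \<in> S \<and> f r = Max (f ` S)"] that \<open>p' \<in> S\<close>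
      unfolding r_def by blast
    ultimately show ?thesis using r S by (simp add: order_less_le)
  qed
  then have "r \<in> records N c f"
    using r q by (auto simp: records_def settled_def S_def)
  then have "r + D \<le> q" using q r by (auto simp: settled_def S_def)
  then have "f r \<le> f q" using mono[of r q] q r(1) by (simp add: settled_def S_def)
  moreover have "f p \<le> f r" using p r(2) S by (simp add: S_def)
  ultimately show ?thesis by simp
qed

text \<open>If \<open>f p < f q\<close>, the first position \<open>r\<close> after \<open>p\<close>
  of the same colour with \<open>f p < f r\<close> is a record: positions up to \<open>p\<close> are
  bounded by \<open>settled_max\<close>, those between by minimality of \<open>r\<close>.\<close>

lemma settled_eq:
  assumes mono: "\<And>p q. p + D \<le> q \<Longrightarrow> q < N \<Longrightarrow> c p = c q \<Longrightarrow> f p \<le> f q"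
    and p: "p \<in> settled D N c f" and q: "q \<in> settled D N c f"
    and pq: "p \<le> q" "c p = c q" and none: "records N c f \<inter> {p<..q} = {}"
  shows "f p = f q"
proof (rule ccontr)
  assume "f p \<noteq> f q"
  moreover have "f p \<le> f q" by (rule settled_max[of D N c f q p]) (fact mono q pq)+
  ultimately have less: "f p < f q" by (simp only: order_less_le simp_thms)
  define Q where "Q r \<longleftrightarrow> p < r \<and> r \<le> q \<and> c r = c p \<and> f p < f r" for r
  define r where "r = (LEAST r. Q r)"
  have "Q q" using less pq by (auto simp: Q_def order_less_le)
  then have r: "Q r" unfolding r_def by (rule LeastI)
  have "f p' < f r" if "p' < r" "c p' = c r" for p'
  proof (cases "p' \<le> p")
    case True
    moreover have "c p' = c p" using that r by (simp add: Q_def)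
    ultimately have "f p' \<le> f p" using settled_max[of D N c f p p'] mono p by blast
    then show ?thesis using r by (auto simp: Q_def)
  next
    case False
    moreover have "\<not> Q p'" using that not_less_Least unfolding r_def by blast
    ultimately have "f p' \<le> f p" using that r by (auto simp: Q_def)
    then show ?thesis using r by (auto simp: Q_def)
  qed
  then have "r \<in> records N c f" using r q by (auto simp: records_def settled_def Q_def)
  then show False using none r by (auto simp: Q_def)
qed

lemma card_records_values:
  assumes "\<And>p. c p < K" "\<And>p. p < N \<Longrightarrow> f p \<in> B" "finite B"
  shows "card (records N c f) \<le> K * card B"
proof -
  have "inj_on (\<lambda>p. (c p, f p)) (records N c f)"
  proof (rule inj_onI)
    fix p q assume *: "p \<in> records N c f" "q \<in> records N c f" "(c p, f p) = (c q, f q)"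
    then show "p = q"
      by (cases p q rule: linorder_cases) (auto simp: records_def)
  qed
  moreover have "(\<lambda>p. (c p, f p)) ` records N c f \<subseteq> {..<K} \<times> B"
    using assms by (auto simp: records_def)
  ultimately have "card (records N c f) \<le> card ({..<K} \<times> B)"
    using assms(3) by (intro card_inj_on_le) auto
  then show ?thesis by (simp add: card_cartesian_product)
qed

text \<open>Think of \<open>f\<close> and \<open>g\<close> as the factors of length \<open>k\<close>
  and \<open>2 * k\<close>. If \<open>p\<close> and \<open>p + k\<close> are settled, their two
  colours and the number of records of \<open>f\<close> up to \<open>p\<close> determine a record
  \<open>p\<close> of \<open>g\<close>: a second one with the same data would have the same
  \<open>g\<close> and the same colour. This gives the quadratic term; the other terms count
  positions where \<open>p\<close> or \<open>p + k\<close> is unsettled or too close to the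
  end.\<close>

lemma card_records_step:
  assumes mono: "\<And>p q. p + D \<le> q \<Longrightarrow> q < N \<Longrightarrow> c p = c q \<Longrightarrow> f p \<le> f q"
    and c: "\<And>p. c p < K" and k: "k \<le> D"
    and fg: "\<And>p q. f p = f q \<Longrightarrow> f (p + k) = f (q + k) \<Longrightarrow> g p = g q"
  shows "card (records N c g) \<le> K\<^sup>2 * (card (records N c f) + 1) + 2 * D * card (records N c f) + k"
proof -
  define J where "J = records N c f"
  define U where "U = {..<N} - settled D N c f"
  define V where "V = {p. p + k \<in> U}"
  define G where "G = {p \<in> records N c g. p \<in> settled D N c f \<and> p + k \<in> settled D N c f}"
  define t where "t p = card (J \<inter> {..p})" for p
  \<comment> \<open>The last \<open>k\<close> positions are discarded too, since there \<open>p + k\<close> need not be a valid position.\<close>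
  have U: "finite U" "card U \<le> D * card J"
    using card_unsettled[of N D c f] by (auto simp: U_def J_def)
  have V: "finite V" "card V \<le> card U"
    using U(1) card_inj_on_le[of "\<lambda>p. p + k" V U] finite_imageD[of "\<lambda>p. p + k" V]
    by (auto simp: V_def intro: finite_subset)
  have sub: "records N c g \<subseteq> G \<union> (U \<union> (V \<union> {N - k..<N}))"
    by (auto simp: G_def U_def V_def records_def)
  have "inj_on (\<lambda>p. (c p, c (p + k), t p)) G"
  proof (rule linorder_inj_onI)
    fix p q assume pq: "p < q" "p \<in> G" "q \<in> G"
    show "(c p, c (p + k), t p) \<noteq> (c q, c (q + k), t q)"
    proof
      assume eq: "(c p, c (p + k), t p) = (c q, c (q + k), t q)"
      have "J \<inter> {..p} = J \<inter> {..q}"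
        using eq pq(1) by (intro card_subset_eq) (auto simp: t_def J_def)
      then have none: "J \<inter> {p<..q} = {}" by (auto simp: set_eq_iff) (metis not_le)
      \<comment> \<open>As \<open>q + k\<close> is settled, every record up to \<open>q + k\<close>
        lies at or before \<open>q + k - D\<close>, hence at or before \<open>q\<close>.\<close>
      have "J \<inter> {q<..q + k} = {}"
        using pq(3) k by (fastforce simp: G_def settled_def J_def)
      with none have none': "J \<inter> {p + k<..q + k} = {}"
        by (auto simp: set_eq_iff) (metis add_lessD1 not_le)
      have "f p = f q"
        by (rule settled_eq[of D N c f p q, OF mono]) (use pq eq none in \<open>auto simp: G_def J_def\<close>)
      moreover have "f (p + k) = f (q + k)"
        by (rule settled_eq[of D N c f "p + k" "q + k", OF mono]) (use pq eq none' in \<open>auto simp: G_def J_def\<close>)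
      ultimately have "g p = g q" by (rule fg)
      then show False using pq eq by (auto simp: G_def records_def)
    qed
  qed auto
  moreover have "(\<lambda>p. (c p, c (p + k), t p)) ` G \<subseteq> {..<K} \<times> {..<K} \<times> {..card J}"
    using c by (auto simp: t_def J_def intro!: card_mono)
  ultimately have "card G \<le> card ({..<K} \<times> {..<K} \<times> {..card J})"
    by (intro card_inj_on_le) auto
  then have G: "card G \<le> K\<^sup>2 * (card J + 1)" by (simp add: power2_eq_square algebra_simps)
  have "card (records N c g) \<le> card (G \<union> (U \<union> (V \<union> {N - k..<N})))"
    using sub U V by (intro card_mono) (auto simp: G_def)
  also have "\<dots> \<le> card G + (card U + (card V + card {N - k..<N}))"
    by (intro order_trans[OF card_Un_le] add_mono order_refl)
  also have "\<dots> \<le> K\<^sup>2 * (card J + 1) + 2 * D * card J + k"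
    using G U V by simp
  finally show ?thesis by (simp add: J_def)
qed

section \<open>Heights of single words\<close>

lemma height_le_singleton_append:
  assumes "height_le {U} Y a" "height_le {V} Y b"
  shows "height_le {U @ V} Y (a + b)"
proof -
  from assms obtain r r' where r: "r \<le> a" "piecewise_power Y r U" "r' \<le> b" "piecewise_power Y r' V"
    by (auto simp: height_le_def)
  then obtain ys ks ys' ks' where
    "length ys = r" "length ks = r" "set ys \<subseteq> Y" "\<forall>k\<in>set ks. 1 \<le> k"
    "U = concat (map (\<lambda>(y, k). concat (replicate k y)) (zip ys ks))"
    "length ys' = r'" "length ks' = r'" "set ys' \<subseteq> Y" "\<forall>k\<in>set ks'. 1 \<le> k"
    "V = concat (map (\<lambda>(y, k). concat (replicate k y)) (zip ys' ks'))"
    unfolding piecewise_power_def by blast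
  then have "piecewise_power Y (r + r') (U @ V)"
    unfolding piecewise_power_def
    by (intro exI[of _ "ys @ ys'"] exI[of _ "ks @ ks'"]) auto
  then show ?thesis using r by (auto simp: height_le_def intro!: exI[of _ "r + r'"])
qed

lemma height_le_mono: "height_le M Y a \<Longrightarrow> a \<le> b \<Longrightarrow> height_le M Y b"
  unfolding height_le_def by (blast intro: order_trans)

lemma height_le_singleton_Nil: "height_le {[]} Y a"
  by (auto simp: height_le_def piecewise_power_def intro!: exI[of _ 0])

lemma height_le_singleton_power:
  assumes "y \<in> Y"
  shows "height_le {concat (replicate k y)} Y 1"
\<comment> \<open>Exponents in \<open>piecewise_power\<close> are at least 1, so the empty word must
  be the product of no powers.\<close>
proof (cases "k = 0")
  case True
  then show ?thesis using height_le_singleton_Nil by simp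
next
  case False
  then have "piecewise_power Y 1 (concat (replicate k y))"
    using assms unfolding piecewise_power_def
    by (intro exI[of _ "[y]"] exI[of _ "[k]"]) auto
  then show ?thesis unfolding height_le_def by auto
qed

lemma height_le_singleton_short:
  assumes "y \<noteq> [] \<Longrightarrow> y \<in> Y"
  shows "height_le {y} Y 1"
  using assms height_le_singleton_power[of y Y 1] height_le_singleton_Nil by (cases "y = []") auto

section \<open>Periodicity of stretches without influence of records\<close>

lemma periodic_eq_power:
  assumes "0 < g" "length x = g" "\<And>i. i < length V \<Longrightarrow> V ! i = x ! (i mod g)"
  obtains r z where "V = concat (replicate r x) @ z" "length z < g"
  using assms
proof (induction "length V" arbitrary: V thesis rule: less_induct)
  case less
  show ?case
  proof (cases "length V < g")
    case True
    then show ?thesis using less.prems(1)[of 0 V] by simp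
  next
    case False
    then have x: "take g V = x"
      using less.prems by (intro nth_equalityI) auto
    have "drop g V ! i = x ! (i mod g)" if "i < length (drop g V)" for i
      using less.prems(4)[of "g + i"] that False by simp
    moreover have "length (drop g V) < length V" using less.prems(2) False by simp
    ultimately obtain r z where "drop g V = concat (replicate r x) @ z" "length z < g"
      using less.hyps[of "drop g V"] less.prems(2,3) by metis
    then have "V = concat (replicate (Suc r) x) @ z"
      using x by (metis append.assoc append_take_drop_id concat.simps(2) replicate_Suc)
    then show ?thesis using \<open>length z < g\<close> less.prems(1) by blast
  qed
qed

lemma pigeonhole_window:
  fixes c :: "nat \<Rightarrow> nat"
  assumes "\<And>p. c p < n - 1" "n > 0"
  obtains p q where "a \<le> p" "p < q" "q < a + n" "c p = c q"
proof -
  have "\<not> inj_on c {a..<a + n}"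
  proof
    assume "inj_on c {a..<a + n}"
    then have "card {a..<a + n} \<le> card {..<n - 1}"
      using assms by (intro card_inj_on_le[of c]) auto
    then show False using assms by simp
  qed
  then obtain p q where "p \<in> {a..<a + n}" "q \<in> {a..<a + n}" "p \<noteq> q" "c p = c q"
    by (auto simp: inj_on_def)
  then show thesis
    using that[of p q] that[of q p] by (cases p q rule: linorder_cases) auto
qed

text \<open>Two of the first \<open>n\<close> positions share a colour, which yields a period
  \<open>g < n\<close>; overlapping windows carry it to the end of the stretch. The three factors
  are the short piece before \<open>p\<close>, a power of a word of length \<open>g\<close>, and a
  remainder shorter than \<open>g\<close>.\<close>

lemma height_le_interval:
  fixes c :: "nat \<Rightarrow> nat" and A :: "'a set" and n :: nat
  defines "Y \<equiv> {y. set y \<subseteq> A \<and> y \<noteq> [] \<and> length y < n}"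
  assumes c: "\<And>p. c p < n - 1" and n: "n > 0" "2 * n \<le> D"
    and W: "set W \<subseteq> A"
    and same: "\<And>p q i. s \<le> p \<Longrightarrow> p < q \<Longrightarrow> q < t \<Longrightarrow> c p = c q \<Longrightarrow> i < D \<Longrightarrow> W ! (p + i) = W ! (q + i)"
    and t: "t \<le> length W"
  shows "height_le {take (t - s) (drop s W)} Y 3"
proof (cases "t < s + n")
  case True
  have "set (take (t - s) (drop s W)) \<subseteq> A"
    using W by (meson in_set_dropD in_set_takeD subset_iff)
  then have "height_le {take (t - s) (drop s W)} Y 1"
    using True n by (intro height_le_singleton_short) (auto simp: Y_def)
  then show ?thesis by (rule height_le_mono) simp
next
  case False
  obtain p q where pq: "s \<le> p" "p < q" "q < s + n" "c p = c q"
    by (rule pigeonhole_window[of c n s, OF c n(1)])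
  define g where "g = q - p"
  have g: "0 < g" "g < n" "q = p + g" using pq by (auto simp: g_def)
  have per: "W ! x = W ! (x - g)" if "q \<le> x" "x < t" for x
    using that
  proof (induction x rule: less_induct)
    case (less x)
    show ?case
    proof (cases "x < q + D")
      case True
      then show ?thesis using same[of p q "x - q"] pq False less.prems g by simp
    next
      case x: False
      \<comment> \<open>Step back by a second period \<open>h\<close>, valid around \<open>x\<close>, then by \<open>g\<close>, then forward by \<open>h\<close>.\<close>
      obtain u v where uv: "x + 1 - D \<le> u" "u < v" "v < (x + 1 - D) + n" "c u = c v"
        by (rule pigeonhole_window[of c n "x + 1 - D", OF c n(1)])
      define h where "h = v - u"
      have h: "0 < h" "h < n" "v = u + h" using uv by (auto simp: h_def)
      have su: "s \<le> u" "v < t" using uv x pq less.prems n by auto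
      \<comment> \<open>Since \<open>2 * n <= D\<close>, the position \<open>v\<close> lies at least
        \<open>n\<close> before \<open>x\<close>, while \<open>x - v < D\<close>. So both
        \<open>x\<close> and \<open>x - g\<close> fall into the factor of length \<open>D\<close> at
        \<open>v\<close>, which equals the one at \<open>u\<close>.\<close>
      have "W ! x = W ! (x - h)"
        using same[of u v "x - v"] su uv h x n by simp
      also have "\<dots> = W ! (x - h - g)"
        using less.IH[of "x - h"] less.prems h x n by simp
      also have "\<dots> = W ! (x - g)"
        using same[of u v "x - g - v"] su uv h x n g by (simp add: add.commute)
      finally show ?thesis .
    qed
  qed
  define V where "V = take (t - p) (drop p W)"
  have lenV: "length V = t - p" using t by (simp add: V_def)
  have Vper: "V ! i = V ! (i mod g)" if "i < length V" for i
    using that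
  proof (induction i rule: less_induct)
    case (less i)
    show ?case
    proof (cases "i < g")
      case False
      have "V ! i = W ! (p + i)" using less.prems t by (simp add: V_def lenV)
      also have "\<dots> = W ! (p + (i - g))"
        using per[of "p + i"] less.prems lenV False g by simp
      also have "\<dots> = V ! (i - g)" using less.prems t by (simp add: V_def lenV)
      also have "\<dots> = V ! ((i - g) mod g)" using less.prems False g by (intro less.IH) auto
      finally show ?thesis using False by (simp add: le_mod_geq)
    qed simp
  qed
  have gV: "g \<le> length V" using lenV False pq g by simp
  obtain r z where rz: "V = concat (replicate r (take g V)) @ z" "length z < g"
    by (rule periodic_eq_power[of g "take g V" V]) (use g gV Vper in auto)
  have setV: "set V \<subseteq> A" "set (take (p - s) (drop s W)) \<subseteq> A"
    using W unfolding V_def by (meson in_set_dropD in_set_takeD subset_iff)+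
  have setx: "set (take g V) \<subseteq> A" using setV(1) by (meson in_set_takeD subset_iff)
  have setz: "set z \<subseteq> A" using setV(1) rz(1) by (metis le_supE set_append)
  have "take (t - s) (drop s W) = take ((p - s) + (t - p)) (drop s W)"
    using pq False by simp
  also have "\<dots> = take (p - s) (drop s W) @ V"
    unfolding V_def take_add using pq by simp
  finally have "take (t - s) (drop s W) = take (p - s) (drop s W) @ concat (replicate r (take g V)) @ z"
    using rz(1) by simp
  moreover have "height_le {take (p - s) (drop s W)} Y 1"
    using setV pq by (intro height_le_singleton_short) (auto simp: Y_def)
  moreover have "height_le {concat (replicate r (take g V))} Y 1"
    using setx g gV by (intro height_le_singleton_power) (auto simp: Y_def)
  moreover have "height_le {z} Y 1"
    using setz rz(2) g by (intro height_le_singleton_short) (auto simp: Y_def)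
  ultimately have "height_le {take (t - s) (drop s W)} Y (1 + (1 + 1))"
    by (simp only: height_le_singleton_append)
  then show ?thesis by (simp add: numeral_3_eq_3)
qed

section \<open>Cutting a word at the positions influenced by records\<close>

text \<open>Each position of \<open>S\<close> becomes a factor of one letter, and each of the at
  most \<open>card S + 1\<close> gaps costs \<open>b\<close>. The induction removes the last such
  position.\<close>

lemma height_le_cut:
  assumes letters: "\<And>a. a \<in> set W \<Longrightarrow> [a] \<in> Y"
    and intervals: "\<And>s t. t \<le> length W \<Longrightarrow> S \<inter> {s..<t} = {} \<Longrightarrow> height_le {take (t - s) (drop s W)} Y b"
    and t: "t \<le> length W"
  shows "height_le {take t W} Y ((b + 1) * card (S \<inter> {..<t}) + b)"
  using t
proof (induction t rule: less_induct)
  case (less t)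
  show ?case
  proof (cases "S \<inter> {..<t} = {}")
    case True
    then show ?thesis using intervals[of t 0] less.prems by (auto simp: atLeast0LessThan)
  next
    case False
    define s where "s = Max (S \<inter> {..<t})"
    have s: "s \<in> S" "s < t" using Max_in[of "S \<inter> {..<t}"] False by (auto simp: s_def)
    have max: "r \<le> s" if "r \<in> S" "r < t" for r
      using that unfolding s_def by (intro Max_ge) auto
    have "S \<inter> {..<t} = insert s (S \<inter> {..<s})"
      using s max by (auto simp: order_le_less)
    then have card: "card (S \<inter> {..<t}) = Suc (card (S \<inter> {..<s}))" by simp
    have none: "S \<inter> {Suc s..<t} = {}" using max by fastforce
    have "take t W = take s W @ [W ! s] @ take (t - Suc s) (drop (Suc s) W)"
      using s less.prems
      by (metis (no_types, lifting) Suc_leI add_diff_inverse_nat append.assoc leD less_le_trans take_Suc_conv_app_nth take_add)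
    moreover have "height_le {take s W} Y ((b + 1) * card (S \<inter> {..<s}) + b)"
      using less s by simp
    moreover have "height_le {[W ! s]} Y 1"
      using letters s less.prems by (intro height_le_singleton_short) auto
    moreover have "height_le {take (t - Suc s) (drop (Suc s) W)} Y b"
      using intervals less.prems none by blast
    ultimately have "height_le {take t W} Y ((b + 1) * card (S \<inter> {..<s}) + b + (1 + b))"
      by (metis height_le_singleton_append)
    then show ?thesis by (rule height_le_mono) (simp add: card)
  qed
qed

lemma height_le_not_n_divisible:
  fixes A :: "'a::linorder set" and n :: nat
  defines "Y \<equiv> {y. set y \<subseteq> A \<and> y \<noteq> [] \<and> length y < n}"
  assumes A: "finite A" "A \<noteq> {}" and n: "n \<ge> 2" and m: "2 * n \<le> 2 ^ m"
    and W: "set W \<subseteq> A" "\<not> n_divisible n W"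
  shows "height_le {W} Y (4 * 2 ^ m * ((n\<^sup>2 + 2 * 2 ^ m) ^ m * (n * card A)) + 3)"
proof -
  define D :: nat where "D = 2 ^ m"
  \<comment> \<open>\<open>N\<close> counts the positions at which a full factor of length
    \<open>D\<close> starts.\<close>
  define N where "N = length W + 1 - D"
  define f where "f k p = take k (drop p W)" for k p
  have D: "D > 0" "2 * n \<le> D" using m by (auto simp: D_def)
  obtain c :: "nat \<Rightarrow> nat" where c: "\<And>p. c p < n - 1"
    and cne: "\<And>p q. prefix_drop D W p q \<Longrightarrow> c p \<noteq> c q"
    using chain_colouring[of "prefix_drop D W" n] chain_imp_n_divisible[of D W _ n] n W D by auto
  have mono: "f k p \<le> f k q" if "p + D \<le> q" "q < N" "c p = c q" "k \<le> D" for k p q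
  proof -
    have "f D p \<le> f D q"
      using cne[of p q] that unfolding prefix_drop_def f_def N_def by force
    from take_mono_lex[OF this, of k] show ?thesis
      using that by (simp add: f_def min_def)
  qed
  \<comment> \<open>The summand 1 turns the affine recursion of \<open>card_records_step\<close>
    into a multiplicative one; the remainder \<open>2 ^ j + 1\<close> is absorbed by
    \<open>2 * D\<close>.\<close>
  define a where "a j = card (records N c (f (2 ^ j))) + 1" for j
  have a0: "a 0 \<le> n * card A"
  proof -
    have "f 1 p \<in> (\<lambda>x. [x]) ` A" if "p < N" for p
    proof -
      have "p < length W" using that D by (simp add: N_def)
      then have "f 1 p = [W ! p]" "W ! p \<in> A"
        using W by (auto simp: f_def Cons_nth_drop_Suc[symmetric])
      then show ?thesis by simp
    qed
    then have "card (records N c (f 1)) \<le> (n - 1) * card ((\<lambda>x. [x]) ` A)"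
      using c A by (intro card_records_values) auto
    also have "card ((\<lambda>x. [x]) ` A) = card A" by (rule card_image) (simp add: inj_on_def)
    finally have "a 0 \<le> (n - 1) * card A + 1" by (simp add: a_def)
    also have "\<dots> \<le> (n - 1) * card A + card A"
      using A by (simp add: Suc_le_eq card_gt_0_iff)
    also have "\<dots> = n * card A" using n by (cases n) auto
    finally show ?thesis .
  qed
  have a_step: "a (Suc j) \<le> (n\<^sup>2 + 2 * D) * a j" if j: "j < m" for j
  proof -
    have k: "2 ^ j \<le> D" using j by (simp add: D_def)
    have "card (records N c (f (2 ^ Suc j))) \<le> (n - 1)\<^sup>2 * (card (records N c (f (2 ^ j))) + 1)
        + 2 * D * card (records N c (f (2 ^ j))) + 2 ^ j"
    proof (rule card_records_step[OF _ c k])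
      show "f (2 ^ j) p \<le> f (2 ^ j) q" if "p + D \<le> q" "q < N" "c p = c q" for p q
        using mono that k by blast
      have split: "f (2 ^ Suc j) p = f (2 ^ j) p @ f (2 ^ j) (p + 2 ^ j)" for p
        by (simp add: f_def mult_2 take_add add.commute)
      show "f (2 ^ Suc j) p = f (2 ^ Suc j) q"
        if "f (2 ^ j) p = f (2 ^ j) q" "f (2 ^ j) (p + 2 ^ j) = f (2 ^ j) (q + 2 ^ j)" for p q
        using that by (simp only: split)
    qed
    also have "\<dots> + 1 \<le> n\<^sup>2 * a j + 2 * D * a j"
    proof -
      have "(n - 1)\<^sup>2 * a j \<le> n\<^sup>2 * a j" by (intro mult_right_mono power_mono) auto
      moreover have "2 * D * card (records N c (f (2 ^ j))) + 2 ^ j + 1 \<le> 2 * D * a j"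
        using k D(1) unfolding a_def distrib_left by simp
      ultimately show ?thesis unfolding a_def by linarith
    qed
    finally show ?thesis by (simp add: a_def distrib_right)
  qed
  have a: "a j \<le> (n\<^sup>2 + 2 * D) ^ j * (n * card A)" if "j \<le> m" for j
    using that
  proof (induction j)
    case (Suc j)
    then have "a (Suc j) \<le> (n\<^sup>2 + 2 * D) * a j" using a_step by simp
    also have "\<dots> \<le> (n\<^sup>2 + 2 * D) * ((n\<^sup>2 + 2 * D) ^ j * (n * card A))"
      using Suc by (intro mult_left_mono) auto
    finally show ?case by (simp add: mult.assoc)
  qed (use a0 in simp)
  \<comment> \<open>\<open>S\<close> also contains the fewer than \<open>D\<close> final positions
    from \<open>N\<close> on, where no full factor starts.\<close>
  define S where "S = {..<length W} - settled D N c (f D)"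
  have "S \<subseteq> ({..<N} - settled D N c (f D)) \<union> {N..<length W}"
    by (auto simp: S_def)
  then have "card S \<le> card ({..<N} - settled D N c (f D)) + card {N..<length W}"
    by (intro order_trans[OF card_mono card_Un_le]) auto
  also have "\<dots> \<le> D * card (records N c (f D)) + D"
    by (intro add_mono card_unsettled) (simp add: N_def)
  also have "\<dots> = D * a m" by (simp add: a_def D_def)
  finally have S: "card S \<le> D * a m" .
  have "height_le {take (t - s) (drop s W)} Y 3" if t: "t \<le> length W" "S \<inter> {s..<t} = {}" for s t
    unfolding Y_def
  proof (rule height_le_interval[OF c _ D(2) W(1) _ t(1)])
    fix p q i assume pq: "s \<le> p" "p < q" "q < t" "c p = c q" "i < D"
    have st: "r \<in> settled D N c (f D)" if "s \<le> r" "r < t" for r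
    proof -
      have "r \<notin> S" using t(2) that by auto
      then show ?thesis using t(1) that by (simp add: S_def)
    qed
    \<comment> \<open>All positions in this range are settled, whereas a record never is, because
      \<open>D > 0\<close>.\<close>
    have none: "records N c (f D) \<inter> {p<..q} = {}"
    proof -
      have "r \<notin> records N c (f D)" if "p < r" "r \<le> q" for r
        using st[of r] that pq D(1) by (auto simp: settled_def)
      then show ?thesis by auto
    qed
    have eq: "f D p = f D q"
    proof (rule settled_eq[of D N c "f D" p q])
      show "f D p \<le> f D q" if "p + D \<le> q" "q < N" "c p = c q" for p q
        using mono that by blast
    qed (use pq st none in simp_all)
    have "q + D \<le> length W" using st[of q] pq by (auto simp: settled_def N_def less_diff_conv)
    then show "W ! (p + i) = W ! (q + i)"
      using arg_cong[OF eq, of "\<lambda>xs. xs ! i"] pq by (simp add: f_def)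
  qed (use n in simp)
  then have "height_le {take (length W) W} Y ((3 + 1) * card (S \<inter> {..<length W}) + 3)"
    using W n by (intro height_le_cut) (auto simp: Y_def)
  moreover have "S \<inter> {..<length W} = S" by (auto simp: S_def)
  ultimately have "height_le {W} Y (4 * card S + 3)" by simp
  moreover have "4 * card S + 3 \<le> 4 * D * ((n\<^sup>2 + 2 * D) ^ m * (n * card A)) + 3"
    using order_trans[OF S mult_left_mono[OF a[OF order_refl]]] by simp
  ultimately show ?thesis unfolding D_def by (rule height_le_mono)
qed

section \<open>Numerical comparison with \<open>Phi\<close>\<close>

text \<open>The iterated logarithm is negative for small \<open>n\<close>, but
  \<open>log 3 n >= 1 / 3\<close> keeps it at least -1, so the constant part of the exponent is
  still at least 55. The rest follows from \<open>log 2 n <= 2 * log 3 n\<close>.\<close>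

lemma Phi_lower_bound:
  fixes n l :: nat
  assumes n: "n \<ge> 2"
  shows "2 ^ 12 * real l * real n powr (9 + 2 * log 2 (real n)) \<le> Phi n l"
proof -
  have L: "log 3 (real n) \<ge> 1 / 3"
  proof -
    have "(3::real) powr (1 / 3) \<le> 8 powr (1 / 3)" by (intro powr_mono2) auto
    also have "(8::real) powr (1 / 3) = (2 powr 3) powr (1 / 3)" by simp
    also have "\<dots> = 2" unfolding powr_powr by simp
    finally show ?thesis using n by (subst le_log_iff) auto
  qed
  have "log 3 (1 / 3) \<le> log 3 (log 3 (real n))" using L by (subst log_le_cancel_iff) auto
  then have LL: "log 3 (log 3 (real n)) \<ge> -1" by (simp add: log_divide)
  have "log 2 (real n) = log 2 3 * log 3 (real n)"
    using n by (simp add: log_def)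
  moreover have "log 2 (3::real) \<le> 2" by (simp add: log_le_iff)
  ultimately have "log 2 (real n) \<le> 2 * log 3 (real n)" using L by (simp add: mult_right_mono)
  then have "9 + 2 * log 2 (real n) \<le> 12 * log 3 (real n) + 36 * log 3 (log 3 (real n)) + 91"
    using L LL by linarith
  then have "real n powr (9 + 2 * log 2 (real n))
      \<le> real n powr (12 * log 3 (real n) + 36 * log 3 (log 3 (real n)) + 91)"
    using n by (intro powr_mono) auto
  then show ?thesis unfolding Phi_def by (intro mult_mono) auto
qed

theorem theoremc:
  fixes A :: "'a::linorder set" and l n :: nat
  assumes "finite A" and "card A = l" and "l \<ge> 1" and "n \<ge> 2"
  defines "M \<equiv> {W. set W \<subseteq> A \<and> \<not> n_divisible n W}"
      and "Y \<equiv> {y. set y \<subseteq> A \<and> y \<noteq> [] \<and> length y < n}"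
  shows "(\<exists>h. height_le M Y h) \<and> real (height M Y) \<le> Phi n l"
proof -
  \<comment> \<open>Minimality gives \<open>2 ^ m <= 4 * n\<close>, which bounds both the power
    itself and \<open>m\<close> by \<open>2 + log 2 n\<close>.\<close>
  define m where "m = (LEAST m. 2 * n \<le> (2::nat) ^ m)"
  have "\<exists>m. 2 * n \<le> (2::nat) ^ m" using less_exp less_imp_le by blast
  then have m: "2 * n \<le> 2 ^ m" unfolding m_def by (rule LeastI_ex)
  have m0: "m \<noteq> 0" using m assms(4) by (cases m) auto
  then have "\<not> 2 * n \<le> 2 ^ (m - 1)" unfolding m_def using not_less_Least by (metis diff_less less_numeral_extra(1) not_gr_zero)
  then have m4: "2 ^ m \<le> 4 * n" using m0 by (cases m) auto
  define h where "h = 4 * 2 ^ m * ((n\<^sup>2 + 2 * 2 ^ m) ^ m * (n * l)) + 3"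
  have "A \<noteq> {}" using assms by auto
  then have h: "height_le M Y h"
    using height_le_not_n_divisible[of A n m] assms m
    unfolding height_le_def M_def Y_def h_def by auto
  have n: "real n \<ge> 2" and l: "real l \<ge> 1" using assms by auto
  have m4': "(2::real) ^ m \<le> 4 * real n" using m4 by (metis of_nat_le_iff of_nat_mult of_nat_numeral of_nat_power)
  have "log 2 ((2::real) ^ m) \<le> log 2 (4 * real n)" using m4' n by (subst log_le_cancel_iff) auto
  then have mlog: "real m \<le> 2 + log 2 (real n)"
    using n log_nat_power[of 2 2 2] by (simp add: log_mult log_nat_power)
  have "(2::real) ^ m \<le> 2 * (real n)\<^sup>2"
    using m4' mult_right_mono[OF n, of "real n"] by (simp add: power2_eq_square)
  then have "(real n)\<^sup>2 + 2 * 2 ^ m \<le> 8 * (real n)\<^sup>2"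
    using zero_le_power2[of "real n"] by linarith
  then have "((real n)\<^sup>2 + 2 * 2 ^ m) ^ m \<le> (8 * (real n)\<^sup>2) ^ m"
    by (intro power_mono) auto
  \<comment> \<open>Rewriting \<open>8 ^ m\<close> as the cube of \<open>2 ^ m\<close> makes its
    contribution polynomial in \<open>n\<close>.\<close>
  also have "\<dots> = (2 ^ m) ^ 3 * (real n) ^ (2 * m)"
    by (simp add: power_mult_distrib power_mult flip: power_mult[of 2 m 3] power_mult[of 2 3 m] mult.commute[of 3 m])
  also have "\<dots> \<le> (4 * real n) ^ 3 * real n powr (2 * (2 + log 2 (real n)))"
  proof (intro mult_mono power_mono m4')
    have "real n ^ (2 * m) = real n powr (real (2 * m))" using n by (subst powr_realpow) auto
    also have "\<dots> \<le> real n powr (2 * (2 + log 2 (real n)))"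
      using n mlog by (intro powr_mono) auto
    finally show "real n ^ (2 * m) \<le> real n powr (2 * (2 + log 2 (real n)))" .
  qed auto
  also have "\<dots> = 64 * real n powr (7 + 2 * log 2 (real n))"
  proof -
    have "real n powr (7 + 2 * log 2 (real n)) = real n powr (3 + 2 * (2 + log 2 (real n)))"
      by (simp add: algebra_simps)
    also have "\<dots> = real n ^ 3 * real n powr (2 * (2 + log 2 (real n)))"
      using n by (subst powr_add) simp
    finally show ?thesis by (simp add: power_mult_distrib)
  qed
  finally have key: "((real n)\<^sup>2 + 2 * 2 ^ m) ^ m \<le> 64 * real n powr (7 + 2 * log 2 (real n))" .
  define E where "E = real n powr (7 + 2 * log 2 (real n))"
  have "0 \<le> log 2 (real n)" by (subst zero_le_log_cancel_iff) (use n in linarith)+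
  then have E1: "E \<ge> 1"
    unfolding E_def by (intro ge_one_powr_ge_zero) (use n in linarith)+
  have "real h = 4 * 2 ^ m * (((real n)\<^sup>2 + 2 * 2 ^ m) ^ m * (real n * real l)) + 3"
    by (simp add: h_def)
  also have "\<dots> \<le> 4 * (4 * real n) * ((64 * E) * (real n * real l)) + 3"
    using key m4' n l unfolding E_def by (intro add_right_mono mult_mono) auto
  also have "\<dots> = 1024 * (real l * (real n * real n * E)) + 3" by simp
  \<comment> \<open>The product is at least 1, so the summand 3 is absorbed; 4096 is the
    \<open>2 ^ 12\<close> of \<open>Phi_lower_bound\<close>.\<close>
  also have "\<dots> \<le> 4096 * (real l * (real n * real n * E))"
  proof -
    have "1 * (1 * 1 * 1) \<le> real l * (real n * real n * E)"
      using n l E1 by (intro mult_mono) auto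
    then show ?thesis by linarith
  qed
  also have "real n * real n * E = real n powr (9 + 2 * log 2 (real n))"
  proof -
    have "real n powr (9 + 2 * log 2 (real n)) = real n powr (2 + (7 + 2 * log 2 (real n)))"
      by (simp add: algebra_simps)
    also have "\<dots> = (real n)\<^sup>2 * E" using n unfolding E_def by (subst powr_add) simp
    finally show ?thesis by (simp add: power2_eq_square)
  qed
  also have "4096 * (real l * \<dots>) \<le> Phi n l"
    using Phi_lower_bound[OF assms(4), of l] by simp
  finally have "real h \<le> Phi n l" .
  moreover have "height M Y \<le> h" unfolding height_def using h by (rule Least_le)
  ultimately show ?thesis using h by fastforce
qed

end
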